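(* For every integer $n\ge 0$, the multipath complex $X(\mathtt{BL}_n)$ of the bidirectional linear digraph $\mathtt{BL}_n$ on $n+1$ vertices is homotopy equivalent to the sphere $S^{\lfloor \frac{n-1}{2}\rfloor}$.
   Context: A digraph has at most one edge $(v,w)$ from $v$ to $w$ for each ordered pair of vertices. For an edge $e=(v,w)$, $s(e)=v$ is its source and $t(e)=w$ its target. A simple path in a digraph is a sequence of edges $e_1,\dots,e_k$ with $s(e_{i+1})=t(e_i)$ for all $i<k$, such that $s(e_i)=s(e_j)$ or $t(e_i)=t(e_j)$ implies $i=j$, and which is not a cycle, i.e. $s(e_1)\neq t(e_k)$. A multipath of a digraph $G$ is a spanning subgraph each of whose connected components is either a single vertex or a simple path. The multipath complex $X(G)$ is the (abstract) simplicial complex whose simplices are the nonempty edge sets of multipaths of $G$ (the empty simplex corresponds to the multipath with no edges); topological statements refer to its geometric realization. For $n\ge 0$, the bidirectional linear digraph $\mathtt{BL}_n$ has $n+1$ vertices $v_0,\dots,v_n$ and the $2n$ edges $(v_i,v_{i+1})$ and $(v_{i+1},v_i)$ for $0\le i\le n-1$; in particular $\mathtt{BL}_0$ is a single vertex with no edges. Convention: $S^{-1}=\emptyset$ (relevant for $n=0$, where the multipath complex is empty). *)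

theory Defs
  imports "HOL-Homology.Homology" "Graph_Theory.Graph_Theory"
begin

definition bidirectional_linear_digraph :: "nat \<Rightarrow> nat pair_pre_digraph" where
  "bidirectional_linear_digraph n =
     \<lparr> pverts = {0..n}, parcs = {(i, i + 1) | i. i < n} \<union> {(i + 1, i) | i. i < n} \<rparr>"

definition simple_path :: "('a, 'b) pre_digraph \<Rightarrow> 'b list \<Rightarrow> bool" where
  "simple_path G p \<longleftrightarrow>
     p \<noteq> [] \<and> set p \<subseteq> arcs G \<and>
     (\<forall>i. i + 1 < length p \<longrightarrow> tail G (p ! (i + 1)) = head G (p ! i)) \<and>
     (\<forall>i < length p. \<forall>j < length p.
        tail G (p ! i) = tail G (p ! j) \<or> head G (p ! i) = head G (p ! j) \<longrightarrow> i = j) \<and>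
     tail G (hd p) \<noteq> head G (last p)"

definition is_single_vertex :: "('a, 'b) pre_digraph \<Rightarrow> bool" where
  "is_single_vertex G \<longleftrightarrow> (\<exists>v. verts G = {v}) \<and> arcs G = {}"

definition is_simple_path :: "('a, 'b) pre_digraph \<Rightarrow> bool" where
  "is_simple_path G \<longleftrightarrow>
     (\<exists>p. simple_path G p \<and> arcs G = set p \<and> verts G = tail G ` set p \<union> head G ` set p)"

(* Connectedness ignores the orientation of the arcs; the qualified name separates it from
   the topological predicate. *)
definition connected_component_of_digraph ::
    "('a, 'b) pre_digraph \<Rightarrow> ('a, 'b) pre_digraph \<Rightarrow> bool" where
  "connected_component_of_digraph G C \<longleftrightarrow> pre_digraph.max_subgraph G Digraph_Component.connected C"

definition multipath :: "('a, 'b) pre_digraph \<Rightarrow> ('a, 'b) pre_digraph \<Rightarrow> bool" where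
  "multipath G H \<longleftrightarrow>
     spanning H G \<and>
     (\<forall>C. connected_component_of_digraph H C \<longrightarrow> is_single_vertex C \<or> is_simple_path C)"

(* An abstract simplicial complex is represented by the set of its nonempty simplices. *)
definition multipath_complex :: "('a, 'b) pre_digraph \<Rightarrow> 'b set set" where
  "multipath_complex G = {arcs H | H. multipath G H \<and> arcs H \<noteq> {}}"

(* Points are given by their barycentric coordinates, extended by 0. The subspace topology used
   here is the usual topology of the realization for complexes with finitely many simplices;
   for infinite complexes it may be coarser than the weak topology. *)
definition geometric_realization :: "'b set set \<Rightarrow> ('b \<Rightarrow> real) topology" where
  "geometric_realization K =
     subtopology (powertop_real UNIV)
       {x. (\<forall>e. 0 \<le> x e) \<and> {e. x e \<noteq> 0} \<in> K \<and> (\<Sum>e | x e \<noteq> 0. x e) = 1}"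

(* The library's nsphere is indexed by nat; the (-1)-sphere is the empty space. Only
   dimensions d \<ge> -1 are meaningful. *)
definition sphere_of_dim :: "int \<Rightarrow> (nat \<Rightarrow> real) topology" where
  "sphere_of_dim d = (if d < 0 then discrete_topology {} else nsphere (nat d))"

end

(* A set of arcs of BL_n is a multipath iff it contains no pair (i, i+1), (j+1, j) with |i - j| <= 1,
   so X(BL_n) is the independence complex of a bipartite graph. Say that (i, i+1) and (i+1, i) have
   index i, call arcs with the same orientation parallel, and group the indices into the blocks
   {2k, 2k+1}. Going through the blocks in increasing order, the weight of the arcs of index 2k+1
   can be pushed linearly onto the parallel arcs of index 2k without leaving the complex. This
   deformation retracts X(BL_n) onto the subcomplex spanned by the arcs of even index, where the
   only conflicts are those between (2k, 2k+1) and (2k+1, 2k): it is the boundary of a cross-polytope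
   with ceil(n/2) pairs of opposite vertices, hence a sphere of dimension ceil(n/2) - 1. *)
theory Submission
  imports Defs
begin

subsection \<open>Multipaths of the bidirectional linear digraph\<close>

text \<open>Compatible digraphs share \<open>tail\<close> and \<open>head\<close>, so distinct ones
  differ in vertices or arcs and one of the two inclusions is proper. Vertices plus arcs thus serve
  as a size for finding maximal subgraphs.\<close>

lemma subgraph_card_less:
  assumes "finite (verts H)" "finite (arcs H)" "subgraph C' H" "subgraph C C'" "C \<noteq> C'"
  shows "card (verts C) + card (arcs C) < card (verts C') + card (arcs C')"
proof -
  have fin: "finite (verts C')" "finite (arcs C')"
    using assms by (auto simp: subgraph_def intro: finite_subset)
  have sub: "verts C \<subseteq> verts C'" "arcs C \<subseteq> arcs C'"
    using assms by (auto simp: subgraph_def)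
  have "verts C \<noteq> verts C' \<or> arcs C \<noteq> arcs C'"
    using assms(4,5) by (auto simp: subgraph_def compatible_def intro: pre_digraph.equality)
  then show ?thesis
    using fin sub by (metis add_le_less_mono add_less_le_mono card_mono psubsetI psubset_card_mono)
qed

text \<open>Finiteness bounds the size, so some connected subgraph containing
  \<open>C\<^sub>0\<close> has the largest size; a proper connected extension would exceed
  it.\<close>

lemma connected_component_of_digraph_exists:
  assumes "finite (verts H)" "finite (arcs H)"
    and "subgraph C\<^sub>0 H" "Digraph_Component.connected C\<^sub>0"
  obtains C where "connected_component_of_digraph H C" "subgraph C\<^sub>0 C"
proof -
  define P where "P C \<longleftrightarrow> subgraph C H \<and> Digraph_Component.connected C \<and> subgraph C\<^sub>0 C" for C
  define f where "f C = card (verts C) + card (arcs C)" for C :: "('a, 'b) pre_digraph"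
  have "P C\<^sub>0"
    using assms by (auto simp: P_def subgraph_def compatible_def)
  moreover have "\<forall>C. P C \<longrightarrow> f C < Suc (f H)"
    using assms by (auto simp: P_def f_def subgraph_def less_Suc_eq_le intro!: add_mono card_mono)
  ultimately obtain C where C: "P C" "\<And>C'. P C' \<Longrightarrow> f C' \<le> f C"
    using ex_has_greatest_nat[of P C\<^sub>0 f] by blast
  have "\<not> (subgraph C' H \<and> Digraph_Component.connected C')"
    if C': "C' \<noteq> C" "subgraph C C'" for C'
  proof
    assume *: "subgraph C' H \<and> Digraph_Component.connected C'"
    then have "P C'"
      using C(1) C' subgraph_trans unfolding P_def by blast
    then show False
      using C(2) subgraph_card_less[OF assms(1,2) _ C'(2)] * C'(1) unfolding f_def by (metis not_le)
  qed
  then have "connected_component_of_digraph H C"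
    using C(1) by (auto simp: connected_component_of_digraph_def pre_digraph.max_subgraph_def P_def)
  then show ?thesis
    using that C(1) by (auto simp: P_def)
qed

text \<open>Two arcs that meet in \<open>w\<close>, together with their ends, form a connected
  subgraph, which extends to a component.\<close>

lemma adjacent_arcs_in_component:
  assumes "wf_digraph H" "finite (verts H)" "finite (arcs H)" "e \<in> arcs H" "e' \<in> arcs H"
    and w: "w \<in> {tail H e, head H e}" "w \<in> {tail H e', head H e'}"
  obtains C where "connected_component_of_digraph H C" "e \<in> arcs C" "e' \<in> arcs C"
    "tail C = tail H" "head C = head H"
proof -
  define C\<^sub>0 where "C\<^sub>0 = \<lparr>verts = {tail H e, head H e, tail H e', head H e'}, arcs = {e, e'},
    tail = tail H, head = head H\<rparr>"
  have wf: "wf_digraph C\<^sub>0"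
    by unfold_locales (auto simp: C\<^sub>0_def)
  have "subgraph C\<^sub>0 H"
    using assms(1,4,5) wf by (auto simp: subgraph_def C\<^sub>0_def compatible_def wf_digraph_def)
  moreover have "Digraph_Component.connected C\<^sub>0"
    unfolding Digraph_Component.connected_def
  proof (rule strongly_connectedI)
    interpret S: pair_wf_digraph "mk_symmetric C\<^sub>0"
      using wf by (rule wf_digraph.wellformed_mk_symmetric)
    show "verts (with_proj (mk_symmetric C\<^sub>0)) \<noteq> {}"
      by (simp add: C\<^sub>0_def)
    fix u v assume uv: "u \<in> verts (with_proj (mk_symmetric C\<^sub>0))" "v \<in> verts (with_proj (mk_symmetric C\<^sub>0))"
    \<comment> \<open>The shared vertex is a hub: every other vertex is joined to \<open>w\<close>
      in both directions after symmetrization, so any two vertices are linked through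
      \<open>w\<close>.\<close>
    have *: "x = w \<or> (x, w) \<in> parcs (mk_symmetric C\<^sub>0) \<and> (w, x) \<in> parcs (mk_symmetric C\<^sub>0)"
      if "x \<in> verts (with_proj (mk_symmetric C\<^sub>0))" for x
      using that w by (auto simp: C\<^sub>0_def parcs_mk_symmetric)
    have "u \<rightarrow>\<^sup>*\<^bsub>with_proj (mk_symmetric C\<^sub>0)\<^esub> w"
      using *[OF uv(1)] uv(1) by auto
    also have "w \<rightarrow>\<^sup>*\<^bsub>with_proj (mk_symmetric C\<^sub>0)\<^esub> v"
      using *[OF uv(2)] uv(2) by auto
    finally show "u \<rightarrow>\<^sup>*\<^bsub>with_proj (mk_symmetric C\<^sub>0)\<^esub> v" .
  qed
  ultimately obtain C where C: "connected_component_of_digraph H C" "subgraph C\<^sub>0 C"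
    using assms connected_component_of_digraph_exists by blast
  then have "e \<in> arcs C" "e' \<in> arcs C" "tail C = tail H" "head C = head H"
    by (auto simp: subgraph_def C\<^sub>0_def compatible_def)
  then show ?thesis
    using that C by blast
qed

section \<open>Pairs of arcs excluded from simple paths\<close>

text \<open>If the head of one arc of a simple path is the tail of another that is not its successor
  in the list, then the former must be the last arc and the latter the first. The path would then
  close up to a cycle.\<close>

lemma simple_path_no_2_cycle:
  assumes "simple_path G p" "e \<in> set p" "e' \<in> set p"
    and "tail G e = head G e'" "head G e = tail G e'"
  shows False
proof -
  have step: "\<And>i. i + 1 < length p \<Longrightarrow> tail G (p ! (i + 1)) = head G (p ! i)"
    and inj: "\<And>i j. \<lbrakk>i < length p; j < length p;
      tail G (p ! i) = tail G (p ! j) \<or> head G (p ! i) = head G (p ! j)\<rbrakk> \<Longrightarrow> i = j"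
    and ends: "p \<noteq> []" "tail G (hd p) \<noteq> head G (last p)"
    using assms(1) unfolding simple_path_def by blast+
  obtain i j where ij: "i < length p" "p ! i = e" "j < length p" "p ! j = e'"
    using assms(2,3) by (auto simp: in_set_conv_nth)
  have succ: "b = Suc a" if "a < length p" "b < length p" "head G (p ! a) = tail G (p ! b)"
    "Suc a < length p" for a b
    using step[of a] inj[of b "Suc a"] that by (metis Suc_eq_plus1)
  have last: "Suc a = length p" if "a < length p" "b < length p" "head G (p ! a) = tail G (p ! b)"
    "b \<noteq> Suc a" for a b
    using succ[of a b] that by linarith
  have pred: "b = 0" if "a < length p" "b < length p" "head G (p ! a) = tail G (p ! b)"
    "b \<noteq> Suc a" for a b
    using step[of "b - 1"] inj[of a "b - 1"] that
    by (cases b) (metis Suc_lessD diff_Suc_1 Suc_eq_plus1)+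
  have "hd p = p ! 0" "last p = p ! (length p - 1)"
    using ends(1) by (simp_all add: hd_conv_nth last_conv_nth)
  then have closed: False if "a < length p" "b < length p" "head G (p ! a) = tail G (p ! b)"
    "b \<noteq> Suc a" for a b
    using last[OF that] pred[OF that] that(3) ends(2) by (metis diff_Suc_1)
  \<comment> \<open>The positions \<open>i\<close> and \<open>j\<close> cannot each be the successor
    of the other, so at least one of the two incidences closes the path.\<close>
  show False
    using closed[of i j] closed[of j i] ij assms(4,5) by (cases "j = Suc i") auto
qed

lemma simple_path_eqI:
  assumes "simple_path G p" "e \<in> set p" "e' \<in> set p"
    and "tail G e = tail G e' \<or> head G e = head G e'"
  shows "e = e'"
  using assms unfolding simple_path_def in_set_conv_nth by metis

section \<open>Multipaths are conflict-free\<close>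

definition bl_arcs :: "nat \<Rightarrow> (nat \<times> nat) set" where
  "bl_arcs n = (\<lambda>i. (i, Suc i)) ` {..<n} \<union> (\<lambda>i. (Suc i, i)) ` {..<n}"

lemma parcs_bidirectional_linear_digraph: "parcs (bidirectional_linear_digraph n) = bl_arcs n"
  by (auto simp: bidirectional_linear_digraph_def bl_arcs_def)

lemma pverts_bidirectional_linear_digraph: "pverts (bidirectional_linear_digraph n) = {0..n}"
  by (simp add: bidirectional_linear_digraph_def)

lemma wf_digraph_subset_bl_arcs:
  assumes "S \<subseteq> bl_arcs n"
  shows "wf_digraph \<lparr>verts = {0..n}, arcs = S, tail = fst, head = snd\<rparr>"
  using assms by unfold_locales (auto simp: bl_arcs_def)

lemma finite_bl_arcs: "finite (bl_arcs n)"
  by (simp add: bl_arcs_def)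

text \<open>The distance |i - j| >= 2 is phrased without truncated subtraction. It fails exactly
  when the two opposite arcs share a vertex.\<close>

definition conflict_free :: "(nat \<times> nat) set \<Rightarrow> bool" where
  "conflict_free S \<longleftrightarrow> (\<forall>i j. (i, Suc i) \<in> S \<longrightarrow> (Suc j, j) \<in> S \<longrightarrow> Suc i < j \<or> Suc j < i)"

text \<open>Conflicting arcs share a vertex and hence lie in one component, which must be a simple
  path. Equal indices give a 2-cycle there, adjacent indices two arcs with the same tail or the same
  head.\<close>

lemma multipath_imp_conflict_free:
  assumes "multipath (with_proj (bidirectional_linear_digraph n)) H"
  shows "conflict_free (arcs H)"
  unfolding conflict_free_def
proof (intro allI impI, rule ccontr)
  fix i j
  assume arcs: "(i, Suc i) \<in> arcs H" "(Suc j, j) \<in> arcs H" and "\<not> (Suc i < j \<or> Suc j < i)"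
  then have cases: "i = j \<or> j = Suc i \<or> i = Suc j"
    by linarith
  have H: "wf_digraph H" "verts H = {0..n}" "arcs H \<subseteq> bl_arcs n" "tail H = fst" "head H = snd"
    using assms by (auto simp: multipath_def spanning_def subgraph_def compatible_def
      parcs_bidirectional_linear_digraph pverts_bidirectional_linear_digraph)
  have fin: "finite (verts H)" "finite (arcs H)"
    using H finite_subset[OF _ finite_bl_arcs] by auto
  \<comment> \<open>In each of the three cases the larger index is a vertex common to both
    arcs.\<close>
  define w where "w = max i j"
  have "w \<in> {tail H (i, Suc i), head H (i, Suc i)}" "w \<in> {tail H (Suc j, j), head H (Suc j, j)}"
    using cases by (auto simp: w_def H)
  then obtain C where C: "connected_component_of_digraph H C" "(i, Suc i) \<in> arcs C"
      "(Suc j, j) \<in> arcs C" "tail C = fst" "head C = snd"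
    using adjacent_arcs_in_component[OF H(1) fin arcs] H(4,5) by metis
  then have "is_simple_path C"
    using assms by (auto simp: multipath_def is_single_vertex_def)
  then obtain p where p: "simple_path C p" "arcs C = set p"
    by (auto simp: is_simple_path_def)
  have in_p: "(i, Suc i) \<in> set p" "(Suc j, j) \<in> set p"
    using C p(2) by simp_all
  consider "i = j" | "tail C (i, Suc i) = tail C (Suc j, j) \<or> head C (i, Suc i) = head C (Suc j, j)"
    using cases C(4,5) by (metis fst_conv snd_conv)
  then show False
  proof cases
    case 1
    then show False
      using simple_path_no_2_cycle[OF p(1) in_p] C(4,5) by simp
  next
    case 2
    then show False
      using simple_path_eqI[OF p(1) in_p] by force
  qed
qed

section \<open>Conflict-free arc sets are multipaths\<close>

text \<open>All arcs join consecutive vertices, so a walk from the vertices up to \<open>i\<close>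
  to those beyond \<open>i\<close> has to traverse an arc of index \<open>i\<close>.\<close>

lemma connected_crosses:
  fixes C :: "(nat, nat \<times> nat) pre_digraph"
  assumes "Digraph_Component.connected C" "tail C = fst" "head C = snd" "arcs C \<subseteq> bl_arcs n"
    and "u \<in> verts C" "v \<in> verts C" "u \<le> i" "i < v"
  shows "(i, Suc i) \<in> arcs C \<or> (Suc i, i) \<in> arcs C"
proof -
  have "(u, v) \<in> rtrancl_on (verts C) (parcs (mk_symmetric C))"
    using assms by (auto simp: Digraph_Component.connected_def strongly_connected_def reachable_def)
  then have "v \<le> i \<or> (i, Suc i) \<in> arcs C \<or> (Suc i, i) \<in> arcs C"
  proof (induction rule: rtrancl_on_induct)
    case base
    then show ?case using assms by simp
  next
    case (step y z)
    then have "(y, z) \<in> arcs C \<or> (z, y) \<in> arcs C"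
      using assms by (auto simp: parcs_mk_symmetric)
    moreover have "z = Suc y \<or> y = Suc z"
      using calculation assms(4) by (auto simp: bl_arcs_def)
    ultimately show ?case
      using step.IH by (metis le_Suc_eq le_antisym not_less_eq_eq)
  qed
  then show ?thesis using assms by simp
qed

lemma simple_path_forward:
  assumes "tail C = fst" "head C = snd" "l < h" "arcs C = (\<lambda>i. (i, Suc i)) ` {l..<h}" "verts C = {l..h}"
  shows "is_simple_path C"
proof -
  define p where "p = map (\<lambda>k. (l + k, Suc (l + k))) [0..<h - l]"
  have len: "length p = h - l" and nth: "\<And>k. k < h - l \<Longrightarrow> p ! k = (l + k, Suc (l + k))"
    by (simp_all add: p_def)
  have "p \<noteq> []"
    using assms by (simp add: p_def)
  then have "hd p = p ! 0" "last p = p ! (h - l - 1)"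
    by (simp_all add: hd_conv_nth last_conv_nth len)
  then have ends: "hd p = (l, Suc l)" "last p = (h - 1, h)"
    using assms(3) by (auto simp: nth)
  have set: "set p = (\<lambda>i. (i, Suc i)) ` {l..<h}"
  proof (intro equalityI subsetI)
    fix e assume "e \<in> (\<lambda>i. (i, Suc i)) ` {l..<h}"
    then obtain i where "l \<le> i" "i < h" "e = (i, Suc i)"
      by auto
    then show "e \<in> set p"
      unfolding p_def set_map by (intro image_eqI[of _ _ "i - l"]) auto
  qed (auto simp: p_def)
  have "simple_path C p"
    unfolding simple_path_def using \<open>p \<noteq> []\<close> set assms ends
    by (auto simp: len nth)
  moreover have "{l..h} = {l..<h} \<union> Suc ` {l..<h}"
    using assms(3) by (auto simp: image_Suc_atLeastLessThan)
  ultimately show ?thesis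
    unfolding is_simple_path_def using set assms by (intro exI[of _ p]) (simp add: image_image)
qed

lemma simple_path_backward:
  assumes "tail C = fst" "head C = snd" "l < h" "arcs C = (\<lambda>i. (Suc i, i)) ` {l..<h}" "verts C = {l..h}"
  shows "is_simple_path C"
proof -
  \<comment> \<open>The list starts at the top vertex \<open>h\<close> and descends; for k < h - l
    no subtraction is truncated.\<close>
  define p where "p = map (\<lambda>k. (h - k, h - Suc k)) [0..<h - l]"
  have len: "length p = h - l" and nth: "\<And>k. k < h - l \<Longrightarrow> p ! k = (h - k, h - Suc k)"
    by (simp_all add: p_def)
  have "p \<noteq> []"
    using assms by (simp add: p_def)
  then have "hd p = p ! 0" "last p = p ! (h - l - 1)"
    by (simp_all add: hd_conv_nth last_conv_nth len)
  then have ends: "hd p = (h, h - 1)" "last p = (Suc l, l)"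
    using assms(3) by (auto simp: nth)
  have set: "set p = (\<lambda>i. (Suc i, i)) ` {l..<h}"
  proof (intro equalityI subsetI)
    fix e assume "e \<in> set p"
    then obtain k where "k < h - l" "e = (h - k, h - Suc k)"
      by (auto simp: p_def)
    then show "e \<in> (\<lambda>i. (Suc i, i)) ` {l..<h}"
      by (intro image_eqI[of _ _ "h - Suc k"]) auto
  next
    fix e assume "e \<in> (\<lambda>i. (Suc i, i)) ` {l..<h}"
    then obtain i where "l \<le> i" "i < h" "e = (Suc i, i)"
      by auto
    then show "e \<in> set p"
      unfolding p_def set_map by (intro image_eqI[of _ _ "h - Suc i"]) auto
  qed
  have "simple_path C p"
    unfolding simple_path_def using \<open>p \<noteq> []\<close> set assms ends
    by (auto simp: len nth)
  moreover have "{l..h} = {l..<h} \<union> Suc ` {l..<h}"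
    using assms(3) by (auto simp: image_Suc_atLeastLessThan)
  ultimately show ?thesis
    unfolding is_simple_path_def using set assms
    by (intro exI[of _ p]) (simp add: image_image Un_commute)
qed

text \<open>Connectedness makes the vertices an interval from \<open>l\<close> to \<open>h\<close>
  with an arc at every index in between. Neighbouring indices cannot carry opposite arcs, so the arc
  at \<open>l\<close> fixes the orientation of all others and the arcs form a directed path.\<close>

lemma conflict_free_connected:
  assumes "wf_digraph C" "Digraph_Component.connected C" "tail C = fst" "head C = snd"
    and "arcs C \<subseteq> bl_arcs n" "conflict_free (arcs C)" "finite (verts C)"
  shows "is_single_vertex C \<or> is_simple_path C"
proof -
  interpret wf_digraph C by fact
  have ne: "verts C \<noteq> {}"
    using assms(2) by (auto simp: Digraph_Component.connected_def strongly_connected_def)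
  define l h where "l = Min (verts C)" and "h = Max (verts C)"
  have lh: "l \<in> verts C" "h \<in> verts C" "verts C \<subseteq> {l..h}"
    using assms(7) ne by (auto simp: l_def h_def)
  have ends: "fst e \<in> verts C" "snd e \<in> verts C" if "e \<in> arcs C" for e
    using tail_in_verts[OF that] head_in_verts[OF that] assms(3,4) by auto
  have between: "l \<le> i" "i < h" if "(i, Suc i) \<in> arcs C \<or> (Suc i, i) \<in> arcs C" for i
    using that ends[of "(i, Suc i)"] ends[of "(Suc i, i)"] lh(3) by auto
  have cross: "(i, Suc i) \<in> arcs C \<or> (Suc i, i) \<in> arcs C" if "l \<le> i" "i < h" for i
    using connected_crosses[OF assms(2-5) lh(1,2) that] .
  have free: "Suc i < j \<or> Suc j < i" if "(i, Suc i) \<in> arcs C" "(Suc j, j) \<in> arcs C" for i j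
    using assms(6) that by (auto simp: conflict_free_def)
  show ?thesis
  proof (cases "l = h")
    case True
    have "verts C = {l}"
      using lh True by auto
    moreover have "arcs C = {}"
    proof (rule ccontr)
      assume "arcs C \<noteq> {}"
      then obtain e where "e \<in> arcs C" by blast
      then show False
        using ends[of e] \<open>verts C = {l}\<close> assms(5) by (auto simp: bl_arcs_def)
    qed
    ultimately show ?thesis
      by (auto simp: is_single_vertex_def)
  next
    case False
    with lh have "l < h" by fastforce
    have verts: "verts C = {l..h}"
    proof
      show "{l..h} \<subseteq> verts C"
      proof
        fix v assume "v \<in> {l..h}"
        then show "v \<in> verts C"
          using cross[of v] ends[of "(v, Suc v)"] ends[of "(Suc v, v)"] lh(2) by (cases "v = h") auto
      qed
    qed (fact lh)
    have form: "\<exists>i. l \<le> i \<and> i < h \<and> (e = (i, Suc i) \<or> e = (Suc i, i))" if "e \<in> arcs C" for e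
    proof -
      have "\<exists>i. e = (i, Suc i) \<or> e = (Suc i, i)"
        using subsetD[OF assms(5) that] unfolding bl_arcs_def by blast
      then obtain i where "e = (i, Suc i) \<or> e = (Suc i, i)" ..
      then show ?thesis
        using that between[of i] by blast
    qed
    show ?thesis
    proof (cases "(l, Suc l) \<in> arcs C")
      case True
      \<comment> \<open>The orientation propagates: some arc of index \<open>Suc i\<close> exists by
        \<open>cross\<close>, and the backward one would conflict with
        \<open>(i, Suc i)\<close>.\<close>
      have fwd: "i < h \<longrightarrow> (i, Suc i) \<in> arcs C" if "l \<le> i" for i
        using that
      proof (induction i rule: dec_induct)
        case (step i)
        then show ?case
          using cross[of "Suc i"] free[of i "Suc i"] by auto
      qed (use True in simp)
      then have "arcs C = (\<lambda>i. (i, Suc i)) ` {l..<h}"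
      proof (intro equalityI subsetI)
        fix e assume "e \<in> arcs C"
        then obtain i where i: "l \<le> i" "i < h" "e = (i, Suc i) \<or> e = (Suc i, i)"
          using form by blast
        have "(Suc i, i) \<notin> arcs C"
          using fwd[OF i(1)] i(2) free[of i i] by auto
        then show "e \<in> (\<lambda>i. (i, Suc i)) ` {l..<h}"
          using i \<open>e \<in> arcs C\<close> by auto
      qed (use fwd in auto)
      then show ?thesis
        using simple_path_forward[OF assms(3,4) \<open>l < h\<close> _ verts] by blast
    next
      case False
      have bwd: "i < h \<longrightarrow> (Suc i, i) \<in> arcs C" if "l \<le> i" for i
        using that
      proof (induction i rule: dec_induct)
        case (step i)
        then show ?case
          using cross[of "Suc i"] free[of "Suc i" i] by auto
      qed (use False cross[of l] in auto)
      then have "arcs C = (\<lambda>i. (Suc i, i)) ` {l..<h}"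
      proof (intro equalityI subsetI)
        fix e assume "e \<in> arcs C"
        then obtain i where i: "l \<le> i" "i < h" "e = (i, Suc i) \<or> e = (Suc i, i)"
          using form by blast
        have "(i, Suc i) \<notin> arcs C"
          using bwd[OF i(1)] i(2) free[of i i] by auto
        then show "e \<in> (\<lambda>i. (Suc i, i)) ` {l..<h}"
          using i \<open>e \<in> arcs C\<close> by auto
      qed (use bwd in auto)
      then show ?thesis
        using simple_path_backward[OF assms(3,4) \<open>l < h\<close> _ verts] by blast
    qed
  qed
qed

text \<open>Subsets of a conflict-free set are conflict-free, so the classification of connected
  conflict-free digraphs applies to each component.\<close>

lemma conflict_free_imp_multipath:
  assumes "S \<subseteq> bl_arcs n" "conflict_free S"
  shows "multipath (with_proj (bidirectional_linear_digraph n))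
    \<lparr>verts = {0..n}, arcs = S, tail = fst, head = snd\<rparr>" (is "multipath ?G ?H")
proof -
  have G: "?G = \<lparr>verts = {0..n}, arcs = bl_arcs n, tail = fst, head = snd\<rparr>"
    by (simp add: with_proj_def parcs_bidirectional_linear_digraph pverts_bidirectional_linear_digraph)
  have "spanning ?H ?G"
    using assms wf_digraph_subset_bl_arcs[of _ n] by (simp add: G spanning_def subgraph_def compatible_def)
  moreover have "is_single_vertex C \<or> is_simple_path C" if "connected_component_of_digraph ?H C" for C
  proof (rule conflict_free_connected[of _ n])
    have C: "subgraph C ?H" "Digraph_Component.connected C"
      using that by (auto simp: connected_component_of_digraph_def pre_digraph.max_subgraph_def)
    then have "arcs C \<subseteq> S"
      by (simp add: subgraph_def)
    then show "arcs C \<subseteq> bl_arcs n" "conflict_free (arcs C)"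
      using assms unfolding conflict_free_def by blast+
    show "wf_digraph C" "Digraph_Component.connected C" "tail C = fst" "head C = snd" "finite (verts C)"
      using C by (auto simp: subgraph_def compatible_def intro: finite_subset)
  qed
  ultimately show ?thesis
    by (simp add: multipath_def)
qed

lemma multipath_complex_bidirectional_linear_digraph:
  "multipath_complex (with_proj (bidirectional_linear_digraph n)) =
     {S. S \<noteq> {} \<and> S \<subseteq> bl_arcs n \<and> conflict_free S}"
proof (intro equalityI subsetI)
  fix S assume "S \<in> multipath_complex (with_proj (bidirectional_linear_digraph n))"
  then obtain H where H: "multipath (with_proj (bidirectional_linear_digraph n)) H" "S = arcs H" "S \<noteq> {}"
    by (auto simp: multipath_complex_def)
  moreover have "arcs H \<subseteq> bl_arcs n"
    using H(1) by (auto simp: multipath_def spanning_def subgraph_def parcs_bidirectional_linear_digraph)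
  ultimately show "S \<in> {S. S \<noteq> {} \<and> S \<subseteq> bl_arcs n \<and> conflict_free S}"
    using multipath_imp_conflict_free by auto
next
  fix S assume "S \<in> {S. S \<noteq> {} \<and> S \<subseteq> bl_arcs n \<and> conflict_free S}"
  then show "S \<in> multipath_complex (with_proj (bidirectional_linear_digraph n))"
    using conflict_free_imp_multipath[of S n] unfolding multipath_complex_def
    by (intro CollectI exI[of _ "\<lparr>verts = {0..n}, arcs = S, tail = fst, head = snd\<rparr>"]) auto
qed

subsection \<open>Folding the geometric realization\<close>

text \<open>Continuity into a product topology can be checked one coordinate at a time, and each
  coordinate of the segment is built from continuous real functions.\<close>

lemma homotopic_with_straight_line:
  fixes f g :: "'a::topological_space \<Rightarrow> 'i \<Rightarrow> real"
  assumes "continuous_on X f" "continuous_on X g"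
    and seg: "\<And>x t. \<lbrakk>x \<in> X; 0 \<le> t; t \<le> 1\<rbrakk> \<Longrightarrow> (\<lambda>i. (1 - t) * f x i + t * g x i) \<in> Y"
  shows "homotopic_with_canon (\<lambda>_. True) X Y f g"
proof -
  have "continuous_on ({0..1::real} \<times> X) (\<lambda>z i. (1 - fst z) * f (snd z) i + fst z * g (snd z) i)"
    using assms(1,2)
    by (intro continuous_on_coordinatewise_then_product continuous_intros
        continuous_on_compose2[OF continuous_on_product_then_coordinatewise[OF assms(1)]]
        continuous_on_compose2[OF continuous_on_product_then_coordinatewise[OF assms(2)]]) auto
  then show ?thesis
    unfolding homotopic_with_def
    by (intro exI[of _ "\<lambda>z i. (1 - fst z) * f (snd z) i + fst z * g (snd z) i"])
      (use seg in \<open>auto simp: image_subset_iff\<close>)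
qed

section \<open>Barycentric coordinates grouped into blocks\<close>

text \<open>Folding moves weight only inside a block, so stating the normalization through these
  sums makes its invariance immediate.\<close>

definition block_sum :: "(nat \<times> nat \<Rightarrow> real) \<Rightarrow> nat \<Rightarrow> real" where
  "block_sum x j = x (2*j, 2*j+1) + x (2*j+1, 2*j+2) + x (2*j+1, 2*j) + x (2*j+2, 2*j+1)"

text \<open>
  The realization with the first \<^term>\<open>k\<close> blocks already folded. For odd \<^term>\<open>n\<close> the last block
  contains the two pairs of index \<^term>\<open>n\<close>, which are not arcs and carry weight 0.
\<close>
definition bl_points :: "nat \<Rightarrow> nat \<Rightarrow> (nat \<times> nat \<Rightarrow> real) set" where
  "bl_points n k = {x. (\<forall>e. 0 \<le> x e) \<and> (\<forall>e. e \<notin> bl_arcs n \<longrightarrow> x e = 0) \<and>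
     (\<Sum>j<(n + 1) div 2. block_sum x j) = 1 \<and> conflict_free {e. x e \<noteq> 0} \<and>
     (\<forall>j<k. x (2*j+1, 2*j+2) = 0 \<and> x (2*j+2, 2*j+1) = 0)}"

lemma bl_pointsD:
  assumes "x \<in> bl_points n k"
  shows "\<And>e. 0 \<le> x e"
    and "\<And>e. e \<notin> bl_arcs n \<Longrightarrow> x e = 0"
    and "(\<Sum>j<(n + 1) div 2. block_sum x j) = 1"
    and "\<And>i j. \<lbrakk>x (i, Suc i) \<noteq> 0; x (Suc j, j) \<noteq> 0\<rbrakk> \<Longrightarrow> Suc i < j \<or> Suc j < i"
    and "\<And>j. j < k \<Longrightarrow> x (2*j+1, 2*j+2) = 0 \<and> x (2*j+2, 2*j+1) = 0"
  using assms unfolding bl_points_def conflict_free_def by blast+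

text \<open>Rounding the number of indices up to the even number \<open>2 * m\<close> adds only zero
  weights and lets the indices be paired. The sum then no longer ranges over the support of
  \<open>x\<close>.\<close>

lemma sum_eq_block_sum:
  assumes "\<And>e. e \<notin> bl_arcs n \<Longrightarrow> x e = 0"
  shows "(\<Sum>e | x e \<noteq> 0. x e) = (\<Sum>j<(n + 1) div 2. block_sum x j)"
proof -
  define m where "m = (n + 1) div 2"
  have "n \<le> 2 * m"
    by (simp add: m_def)
  then have "bl_arcs n \<subseteq> bl_arcs (2 * m)"
    by (auto simp: bl_arcs_def)
  then have "(\<Sum>e | x e \<noteq> 0. x e) = (\<Sum>e\<in>bl_arcs (2 * m). x e)"
    using assms by (intro sum.mono_neutral_left finite_bl_arcs) auto
  also have "\<dots> = (\<Sum>i<2 * m. x (i, Suc i)) + (\<Sum>i<2 * m. x (Suc i, i))"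
    unfolding bl_arcs_def
    by (subst sum.union_disjoint) (auto simp: sum.reindex inj_on_def)
  also have "\<dots> = (\<Sum>j<m. block_sum x j)"
    by (induction m) (simp_all add: block_sum_def algebra_simps)
  finally show ?thesis
    by (simp add: m_def)
qed

lemma geometric_realization_bidirectional_linear_digraph:
  "geometric_realization (multipath_complex (with_proj (bidirectional_linear_digraph n))) =
     top_of_set (bl_points n 0)"
proof -
  have "{x. (\<forall>e. 0 \<le> x e) \<and> {e. x e \<noteq> 0} \<in> multipath_complex (with_proj (bidirectional_linear_digraph n))
      \<and> (\<Sum>e | x e \<noteq> 0. x e) = 1} = bl_points n 0" (is "?L = _")
  proof (intro equalityI subsetI)
    fix x assume "x \<in> ?L"
    then have *: "\<forall>e. 0 \<le> x e" "\<And>e. e \<notin> bl_arcs n \<Longrightarrow> x e = 0" "conflict_free {e. x e \<noteq> 0}"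
        "(\<Sum>e | x e \<noteq> 0. x e) = 1"
      unfolding multipath_complex_bidirectional_linear_digraph by auto
    then show "x \<in> bl_points n 0"
      using sum_eq_block_sum[OF *(2)] by (simp add: bl_points_def)
  next
    fix x assume x: "x \<in> bl_points n 0"
    then have "(\<Sum>e | x e \<noteq> 0. x e) = 1"
      using sum_eq_block_sum[OF bl_pointsD(2)[OF x]] bl_pointsD(3)[OF x] by simp
    \<comment> \<open>A nonempty support is automatic, since an empty sum is 0 and not 1.\<close>
    moreover from this have "{e. x e \<noteq> 0} \<noteq> {}"
      by (metis sum.empty zero_neq_one)
    ultimately show "x \<in> ?L"
      using x unfolding multipath_complex_bidirectional_linear_digraph bl_points_def by auto
  qed
  then show ?thesis
    by (simp add: geometric_realization_def euclidean_product_topology)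
qed

section \<open>Folding one block\<close>

definition block_fold :: "nat \<Rightarrow> (nat \<times> nat \<Rightarrow> real) \<Rightarrow> nat \<times> nat \<Rightarrow> real" where
  "block_fold k x e =
     (if e = (2*k, 2*k+1) then x (2*k, 2*k+1) + x (2*k+1, 2*k+2)
      else if e = (2*k+1, 2*k) then x (2*k+1, 2*k) + x (2*k+2, 2*k+1)
      else if e = (2*k+1, 2*k+2) \<or> e = (2*k+2, 2*k+1) then 0
      else x e)"

lemma block_sum_block_fold: "block_sum (block_fold k x) j = block_sum x j"
  by (cases "j = k") (auto simp: block_sum_def block_fold_def)

lemma block_fold_id:
  assumes "x \<in> bl_points n (Suc k)"
  shows "block_fold k x = x"
  using assms by (auto simp: bl_points_def block_fold_def fun_eq_iff)

text \<open>Block sums are linear and preserved by the fold, hence constant along the segment. An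
  arc that newly enters the support has index 2k and receives its weight from the parallel arc of
  index 2k+1, so conflicts can be traced back to \<open>x\<close>.\<close>

lemma block_fold_segment:
  assumes x: "x \<in> bl_points n k" and t: "0 \<le> t" "t \<le> 1"
  shows "(\<lambda>e. (1 - t) * x e + t * block_fold k x e) \<in> bl_points n k"
proof -
  let ?z = "\<lambda>e. (1 - t) * x e + t * block_fold k x e"
  note pos = bl_pointsD(1)[OF x] and supp = bl_pointsD(2)[OF x] and sum = bl_pointsD(3)[OF x]
    and free = bl_pointsD(4)[OF x] and folded = bl_pointsD(5)[OF x]
  have "0 \<le> ?z e" for e
    using pos t by (auto simp: block_fold_def)
  moreover have "?z e = 0" if "e \<notin> bl_arcs n" for e
  proof -
    \<comment> \<open>Weight is never pushed onto a non-arc: if index 2k is out of range, so is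
      2k+1.\<close>
    have "x (2*k+1, 2*k+2) = 0" if "(2*k, 2*k+1) \<notin> bl_arcs n"
      using that by (intro supp) (auto simp: bl_arcs_def)
    moreover have "x (2*k+2, 2*k+1) = 0" if "(2*k+1, 2*k) \<notin> bl_arcs n"
      using that by (intro supp) (auto simp: bl_arcs_def)
    ultimately show ?thesis
      using that supp[OF that] by (auto simp: block_fold_def)
  qed
  moreover have "(\<Sum>j<(n + 1) div 2. block_sum ?z j) = 1"
  proof -
    have "block_sum ?z j = (1 - t) * block_sum x j + t * block_sum (block_fold k x) j" for j
      by (simp add: block_sum_def algebra_simps)
    then have "block_sum ?z j = block_sum x j" for j
      by (simp add: block_sum_block_fold algebra_simps)
    then show ?thesis
      using sum by simp
  qed
  moreover have "conflict_free {e. ?z e \<noteq> 0}"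
    unfolding conflict_free_def
  proof (intro allI impI)
    fix i j assume "(i, Suc i) \<in> {e. ?z e \<noteq> 0}" "(Suc j, j) \<in> {e. ?z e \<noteq> 0}"
    then have "x (i, Suc i) \<noteq> 0 \<or> i = 2*k \<and> x (Suc (2*k), Suc (Suc (2*k))) \<noteq> 0"
      and "x (Suc j, j) \<noteq> 0 \<or> j = 2*k \<and> x (Suc (Suc (2*k)), Suc (2*k)) \<noteq> 0"
      by (auto simp: block_fold_def split: if_splits)
    moreover have "\<exists>l<k. j = 2*l+1" if "Suc j = 2*k" for j
      using that by (intro exI[of _ "k - 1"]) auto
    then have "x (j, Suc j) = 0" "x (Suc j, j) = 0" if "Suc j = 2*k" for j
      using folded that by fastforce+
    \<comment> \<open>An arc of index \<^term>\<open>2 * k + 1\<close> conflicts with everything the parallel arc of index \<^term>\<open>2 * k\<close>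
      conflicts with, except the arc of index \<^term>\<open>2 * k - 1\<close>, which was folded away before.\<close>
    ultimately show "Suc i < j \<or> Suc j < i"
      using free[of i j] free[of "Suc (2*k)" j] free[of i "Suc (2*k)"] free[of "Suc (2*k)" "Suc (2*k)"]
      by (metis Suc_lessI less_antisym less_irrefl not_less_eq Suc_lessD)
  qed
  moreover have "?z (2*j+1, 2*j+2) = 0 \<and> ?z (2*j+2, 2*j+1) = 0" if "j < k" for j
    using folded[OF that] that by (auto simp: block_fold_def)
  ultimately show ?thesis
    by (simp add: bl_points_def)
qed

lemma block_fold_in:
  assumes "x \<in> bl_points n k"
  shows "block_fold k x \<in> bl_points n (Suc k)"
proof -
  have "block_fold k x \<in> bl_points n k"
    using block_fold_segment[OF assms, of 1] by simp
  moreover have "block_fold k x (2*k+1, 2*k+2) = 0 \<and> block_fold k x (2*k+2, 2*k+1) = 0"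
    by (simp add: block_fold_def)
  ultimately show ?thesis
    by (simp add: bl_points_def less_Suc_eq)
qed

lemma bl_points_Suc_subset: "bl_points n (Suc k) \<subseteq> bl_points n k"
  by (auto simp: bl_points_def)

lemma continuous_on_block_fold: "continuous_on S (block_fold k)"
proof -
  have [continuous_intros]: "continuous_on S (\<lambda>x::nat \<times> nat \<Rightarrow> real. x e)" for e
    by (rule continuous_on_subset[OF continuous_on_product_coordinates]) simp
  \<comment> \<open>The case distinctions in \<open>block_fold\<close> depend on the coordinate
    \<open>e\<close> only, not on the point, so no gluing of continuous pieces is required.\<close>
  have continuous_on_if_const: "continuous_on S (\<lambda>x::nat \<times> nat \<Rightarrow> real. if b then f x else g x)"
    if "continuous_on S f" "continuous_on S g" for b and f g :: "(nat \<times> nat \<Rightarrow> real) \<Rightarrow> real"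
    using that by (cases b) auto
  show ?thesis
    unfolding block_fold_def
    by (intro continuous_on_coordinatewise_then_product continuous_intros continuous_on_if_const)
qed

text \<open>The fold maps stage \<open>k\<close> into the next stage and fixes the latter pointwise,
  and the segments from each point to its image stay in stage \<open>k\<close>: a deformation
  retraction.\<close>

lemma bl_points_Suc_homotopy_equivalent:
  "top_of_set (bl_points n k) homotopy_equivalent_space top_of_set (bl_points n (Suc k))"
proof (rule deformation_retract_imp_homotopy_equivalent_space)
  have "homotopic_with_canon (\<lambda>_. True) (bl_points n k) (bl_points n k) id (block_fold k)"
    using block_fold_segment by (intro homotopic_with_straight_line continuous_on_block_fold) auto
  then show "homotopic_with_canon (\<lambda>_. True) (bl_points n k) (bl_points n k) (block_fold k) id"
    by (rule homotopic_with_symD)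
  show "retraction_maps (top_of_set (bl_points n k)) (top_of_set (bl_points n (Suc k))) (block_fold k) id"
    using block_fold_in block_fold_id bl_points_Suc_subset[of n k]
    by (auto simp: retraction_maps_def continuous_on_block_fold)
qed

lemma bl_points_homotopy_equivalent:
  "top_of_set (bl_points n 0) homotopy_equivalent_space top_of_set (bl_points n k)"
proof (induction k)
  case (Suc k)
  then show ?case
    using bl_points_Suc_homotopy_equivalent homotopy_eqv_trans by blast
qed (rule homotopy_equivalent_space_refl)

subsection \<open>The cross-polytope\<close>

text \<open>Places the opposite vertices \<open>(2*k, 2*k+1)\<close> and \<open>(2*k+1, 2*k)\<close>
  of the cross-polytope on the positive and negative half of axis \<open>k\<close>.\<close>

definition signed_coordinate :: "(nat \<times> nat \<Rightarrow> real) \<Rightarrow> nat \<Rightarrow> real" where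
  "signed_coordinate x k = x (2*k, 2*k+1) - x (2*k+1, 2*k)"

text \<open>Radial projection onto the Euclidean unit sphere.\<close>

definition to_sphere :: "nat \<Rightarrow> (nat \<times> nat \<Rightarrow> real) \<Rightarrow> nat \<Rightarrow> real" where
  "to_sphere m x k = signed_coordinate x k / sqrt (\<Sum>j<m. (signed_coordinate x j)\<^sup>2)"

text \<open>Radial projection onto the unit sphere of the 1-norm, each coordinate being split into
  its positive and negative part.\<close>

definition from_sphere :: "nat \<Rightarrow> (nat \<Rightarrow> real) \<Rightarrow> nat \<times> nat \<Rightarrow> real" where
  "from_sphere m z e =
     (if even (fst e) \<and> snd e = fst e + 1 then max 0 (z (fst e div 2))
      else if even (snd e) \<and> fst e = snd e + 1 then max 0 (- z (snd e div 2))
      else 0) / (\<Sum>j<m. \<bar>z j\<bar>)"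

text \<open>Conflict-freeness makes one of the two arcs of index 2k vanish, so their weights are the
  positive and negative parts of the signed coordinate and each block sum is its absolute value. The
  folded points thus form the unit sphere of the 1-norm.\<close>

lemma bl_points_folded:
  assumes "x \<in> bl_points n ((n + 1) div 2)"
  shows "\<And>e. 0 \<le> x e"
    and "\<And>k. x (2*k, 2*k+1) = max 0 (signed_coordinate x k)"
    and "\<And>k. x (2*k+1, 2*k) = max 0 (- signed_coordinate x k)"
    and "\<And>k. (n + 1) div 2 \<le> k \<Longrightarrow> signed_coordinate x k = 0"
    and "(\<Sum>k<(n + 1) div 2. \<bar>signed_coordinate x k\<bar>) = 1"
    and "\<And>a b. x (a, b) \<noteq> 0 \<Longrightarrow> even a \<and> b = a + 1 \<or> even b \<and> a = b + 1"
proof -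
  note pos = bl_pointsD(1)[OF assms] and supp = bl_pointsD(2)[OF assms] and sum = bl_pointsD(3)[OF assms]
    and free = bl_pointsD(4)[OF assms] and folded = bl_pointsD(5)[OF assms]
  show "0 \<le> x e" for e
    by (rule pos)
  have disj: "x (2*k, 2*k+1) = 0 \<or> x (2*k+1, 2*k) = 0" for k
    using free[of "2*k" "2*k"] by auto
  show fwd: "x (2*k, 2*k+1) = max 0 (signed_coordinate x k)"
    and bwd: "x (2*k+1, 2*k) = max 0 (- signed_coordinate x k)" for k
    using disj[of k] pos[of "(2*k, 2*k+1)"] pos[of "(2*k+1, 2*k)"]
    by (auto simp: signed_coordinate_def max_def)
  show "signed_coordinate x k = 0" if "(n + 1) div 2 \<le> k" for k
  proof -
    have "(2*k, 2*k+1) \<notin> bl_arcs n" "(2*k+1, 2*k) \<notin> bl_arcs n"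
      using that by (auto simp: bl_arcs_def)
    then show ?thesis
      using supp by (simp add: signed_coordinate_def)
  qed
  have "block_sum x k = \<bar>signed_coordinate x k\<bar>" if "k < (n + 1) div 2" for k
    using folded[OF that] fwd[of k] bwd[of k] by (simp add: block_sum_def)
  then show "(\<Sum>k<(n + 1) div 2. \<bar>signed_coordinate x k\<bar>) = 1"
    using sum by simp
  show "even a \<and> b = a + 1 \<or> even b \<and> a = b + 1" if ab: "x (a, b) \<noteq> 0" for a b
  proof (rule ccontr)
    assume no: "\<not> ?thesis"
    have "(a, b) \<in> bl_arcs n"
      using ab supp by blast
    then have *: "b = Suc a \<and> a < n \<and> odd a \<or> a = Suc b \<and> b < n \<and> odd b"
      using no by (auto simp: bl_arcs_def)
    \<comment> \<open>The index of the arc \<open>(a, b)\<close> is \<open>min a b\<close>; being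
      odd, it is the second index of block \<open>j\<close>, which has been folded away.\<close>
    define j where "j = min a b div 2"
    have "j < (n + 1) div 2" "(a, b) = (2*j+1, 2*j+2) \<or> (a, b) = (2*j+2, 2*j+1)"
      using * by (auto simp: j_def min_def elim!: oddE)
    then show False
      using folded ab by blast
  qed
qed

text \<open>The positive and negative parts of one coordinate are never both nonzero, and dividing
  by the 1-norm gives total weight 1.\<close>

lemma from_sphere_in:
  assumes "\<And>k. (n + 1) div 2 \<le> k \<Longrightarrow> z k = 0" "(\<Sum>j<(n + 1) div 2. \<bar>z j\<bar>) \<noteq> 0"
  shows "from_sphere ((n + 1) div 2) z \<in> bl_points n ((n + 1) div 2)"
proof -
  define m where "m = (n + 1) div 2"
  define s where "s = (\<Sum>j<m. \<bar>z j\<bar>)"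
  have "s > 0"
    using assms(2) by (simp add: s_def m_def less_le sum_nonneg)
  have "0 \<le> from_sphere m z e" for e
    using \<open>s > 0\<close> by (simp add: from_sphere_def flip: s_def)
  moreover have "from_sphere m z e = 0" if "e \<notin> bl_arcs n" for e
  proof -
    have "z k = 0" if "e = (2*k, 2*k+1) \<or> e = (2*k+1, 2*k)" for k
      using \<open>e \<notin> bl_arcs n\<close> that by (intro assms(1)) (auto simp: bl_arcs_def)
    then show ?thesis
      by (cases e) (auto simp: from_sphere_def elim!: evenE)
  qed
  moreover have "(\<Sum>j<m. block_sum (from_sphere m z) j) = 1"
  proof -
    have "block_sum (from_sphere m z) j = \<bar>z j\<bar> / s" for j
      by (simp add: block_sum_def from_sphere_def flip: s_def) (simp add: max_def abs_if flip: add_divide_distrib)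
    then show ?thesis
      using \<open>s > 0\<close> by (simp flip: sum_divide_distrib s_def)
  qed
  moreover have "conflict_free {e. from_sphere m z e \<noteq> 0}"
    unfolding conflict_free_def
  proof (intro allI impI)
    fix i j assume "(i, Suc i) \<in> {e. from_sphere m z e \<noteq> 0}" "(Suc j, j) \<in> {e. from_sphere m z e \<noteq> 0}"
    then have "even i" "z (i div 2) > 0" "even j" "z (j div 2) < 0"
      by (auto simp: from_sphere_def max_def split: if_splits)
    \<comment> \<open>Opposite signs force distinct indices, and distinct even numbers differ by at
      least 2.\<close>
    then have "i \<noteq> j" "even i" "even j"
      by auto
    then show "Suc i < j \<or> Suc j < i"
      by (auto elim!: evenE)
  qed
  moreover have "from_sphere m z (2*j+1, 2*j+2) = 0 \<and> from_sphere m z (2*j+2, 2*j+1) = 0" for j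
    by (simp add: from_sphere_def)
  ultimately show ?thesis
    by (simp add: bl_points_def m_def)
qed

lemma sum_power2_pos:
  fixes z :: "'a \<Rightarrow> real"
  assumes "finite A" "(\<Sum>j\<in>A. \<bar>z j\<bar>) \<noteq> 0"
  shows "0 < (\<Sum>j\<in>A. (z j)\<^sup>2)"
proof -
  obtain j where "j \<in> A" "z j \<noteq> 0"
    using assms(2) by (metis abs_zero sum.neutral)
  then show ?thesis
    by (intro sum_pos2[OF assms(1), of j]) auto
qed

lemma signed_coordinate_from_sphere:
  "signed_coordinate (from_sphere m z) k = z k / (\<Sum>j<m. \<bar>z j\<bar>)"
  by (simp add: signed_coordinate_def from_sphere_def max_def flip: diff_divide_distrib)

text \<open>Every ray from the origin meets the cross-polytope boundary and the Euclidean sphere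
  once each, so the two radial projections are mutually inverse.\<close>

lemma bl_points_homeomorphic_nsphere:
  assumes "n \<ge> 1"
  shows "top_of_set (bl_points n ((n + 1) div 2)) homeomorphic_space nsphere ((n + 1) div 2 - 1)"
proof -
  define m where "m = (n + 1) div 2"
  define X where "X = bl_points n m"
  define Z where "Z = {z::nat \<Rightarrow> real. (\<Sum>k<m. (z k)\<^sup>2) = 1 \<and> (\<forall>k\<ge>m. z k = 0)}"
  have "m \<ge> 1"
    using assms by (simp add: m_def)
  \<comment> \<open>The coordinates of \<open>nsphere d\<close> run up to \<open>d\<close>
    inclusive; as m >= 1, dimension m - 1 gives exactly \<open>m\<close> of them.\<close>
  then have "{..m - 1} = {..<m}" "\<And>k. m - 1 < k \<longleftrightarrow> m \<le> k"
    by auto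
  then have Z: "nsphere (m - 1) = top_of_set Z"
    by (simp add: nsphere euclidean_product_topology Z_def)
  have [continuous_intros]: "continuous_on S (\<lambda>x. x i)" for S and i :: 'i and x :: "'i \<Rightarrow> real"
    by (rule continuous_on_subset[OF continuous_on_product_coordinates]) simp
  note folded = bl_points_folded[where n = n, folded m_def X_def]
  have Zpos: "0 < (\<Sum>k<m. \<bar>z k\<bar>)" if "z \<in> Z" for z
  proof -
    have "(\<Sum>k<m. \<bar>z k\<bar>) \<noteq> 0"
    proof
      assume "(\<Sum>k<m. \<bar>z k\<bar>) = 0"
      then have "\<forall>k<m. z k = 0"
        by (simp add: sum_nonneg_eq_0_iff)
      then show False
        using that by (simp add: Z_def)
    qed
    then show ?thesis
      by (simp add: less_le sum_nonneg)
  qed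
  have Xpos: "0 < (\<Sum>k<m. (signed_coordinate x k)\<^sup>2)" if "x \<in> X" for x
    using folded(5)[OF that] by (intro sum_power2_pos) auto
  have "to_sphere m x \<in> Z" if "x \<in> X" for x
  proof -
    have "(\<Sum>k<m. (to_sphere m x k)\<^sup>2) = 1"
      using Xpos[OF that] by (simp add: to_sphere_def power_divide flip: sum_divide_distrib)
    then show ?thesis
      using folded(4)[OF that] by (simp add: Z_def to_sphere_def)
  qed
  moreover have "continuous_on X (to_sphere m)"
  proof (rule continuous_on_coordinatewise_then_product)
    fix k
    have "sqrt (\<Sum>k<m. (signed_coordinate x k)\<^sup>2) \<noteq> 0" if "x \<in> X" for x
      using Xpos[OF that] by simp
    then show "continuous_on X (\<lambda>x. to_sphere m x k)"
      unfolding to_sphere_def signed_coordinate_def by (intro continuous_intros) auto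
  qed
  moreover have "from_sphere m z \<in> X" if "z \<in> Z" for z
    unfolding X_def m_def using that Zpos[OF that]
    by (intro from_sphere_in) (simp_all add: Z_def m_def)
  moreover have "continuous_on Z (from_sphere m)"
  proof (rule continuous_on_coordinatewise_then_product)
    fix e
    show "continuous_on Z (\<lambda>z. from_sphere m z e)"
      using Zpos unfolding from_sphere_def
      by (cases "even (fst e) \<and> snd e = fst e + 1"; cases "even (snd e) \<and> fst e = snd e + 1")
        (auto intro!: continuous_intros simp: less_le)
  qed
  moreover have "from_sphere m (to_sphere m x) = x" if x: "x \<in> X" for x
  proof
    fix e
    define r where "r = sqrt (\<Sum>k<m. (signed_coordinate x k)\<^sup>2)"
    have "r > 0"
      using Xpos[OF x] by (simp add: r_def)
    have to: "to_sphere m x k = signed_coordinate x k / r" for k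
      by (simp add: to_sphere_def r_def)
    \<comment> \<open>The 1-norm of \<open>x\<close> is 1, so normalizing the image by its own
      1-norm cancels the factor 1 / r.\<close>
    have "(\<Sum>k<m. \<bar>to_sphere m x k\<bar>) = 1 / r"
      using folded(5)[OF x] \<open>r > 0\<close> by (simp add: to abs_divide flip: sum_divide_distrib)
    moreover have "max 0 (a / r) = max 0 a / r" "max 0 (- (a / r)) = max 0 (- a) / r" for a
      using \<open>r > 0\<close> by (auto simp: max_def divide_simps)
    ultimately have "from_sphere m (to_sphere m x) e =
        (if even (fst e) \<and> snd e = fst e + 1 then max 0 (signed_coordinate x (fst e div 2))
         else if even (snd e) \<and> fst e = snd e + 1 then max 0 (- signed_coordinate x (snd e div 2))
         else 0)"
      using \<open>r > 0\<close> by (simp add: from_sphere_def to)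
    also have "\<dots> = x e"
      using folded(2,3)[OF x] folded(6)[OF x, of "fst e" "snd e"] by (cases e) (auto elim!: evenE)
    finally show "from_sphere m (to_sphere m x) e = x e" .
  qed
  moreover have "to_sphere m (from_sphere m z) = z" if z: "z \<in> Z" for z
  proof
    fix k
    have "(\<Sum>j<m. (z j)\<^sup>2) = 1"
      using z by (simp add: Z_def)
    then show "to_sphere m (from_sphere m z) k = z k"
      using Zpos[OF z]
      by (simp add: to_sphere_def signed_coordinate_from_sphere power_divide real_sqrt_divide flip: sum_divide_distrib)
  qed
  ultimately have "homeomorphic_maps (top_of_set X) (top_of_set Z) (to_sphere m) (from_sphere m)"
    by (auto simp: homeomorphic_maps_def)
  then show ?thesis
    unfolding Z[symmetric] X_def m_def homeomorphic_space_def by blast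
qed

theorem proposition2p2:
  fixes n :: nat
  shows "geometric_realization (multipath_complex (with_proj (bidirectional_linear_digraph n)))
           homotopy_equivalent_space sphere_of_dim \<lfloor>(real n - 1) / 2\<rfloor>"
proof (cases "n = 0")
  case True
  \<comment> \<open>There are no blocks, so the total weight is an empty sum and cannot equal
    1.\<close>
  have "bl_points 0 0 = {}"
    by (auto simp: bl_points_def)
  then have "top_of_set (bl_points 0 0) homeomorphic_space discrete_topology ({} :: (nat \<Rightarrow> real) set)"
    by (simp add: homeomorphic_empty_space_eq)
  then show ?thesis
    using True unfolding geometric_realization_bidirectional_linear_digraph
    by (simp add: sphere_of_dim_def homeomorphic_imp_homotopy_equivalent_space)
next
  case False
  have "\<lfloor>(real n - 1) / 2\<rfloor> = int ((n + 1) div 2 - 1)"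
  proof -
    \<comment> \<open>As a quotient of integers the floor becomes integer division; n > 0 then keeps
      the natural-number subtraction from truncating.\<close>
    have "(real n - 1) / 2 = real_of_int (int n - 1) / real_of_int 2"
      by simp
    then have "\<lfloor>(real n - 1) / 2\<rfloor> = (int n - 1) div 2"
      by (metis floor_divide_of_int_eq)
    then show ?thesis
      using False by linarith
  qed
  then have "sphere_of_dim \<lfloor>(real n - 1) / 2\<rfloor> = nsphere ((n + 1) div 2 - 1)"
    by (simp add: sphere_of_dim_def)
  then show ?thesis
    using False bl_points_homotopy_equivalent homotopy_eqv_trans
      homeomorphic_imp_homotopy_equivalent_space[OF bl_points_homeomorphic_nsphere[of n]]
    unfolding geometric_realization_bidirectional_linear_digraph by fastforce
qed

end
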